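(* Let $p\ge2$ and $1\le t\le p$ be integers, and let $c=c(p,2,t)>0$ be a constant, depending only on $p$ and $t$, such that $$f_t^\sharp(n,p,2)\le c\cdot 2^{\frac{(n-p)\binom{p}{\lfloor p/2\rfloor}(1+o(1))}{h_p(t)-1}}\qquad\text{for all } n\ge p,$$ where $o(1)\to0$ as $n\to\infty$ with $p,t$ fixed. Then, as $k\to\infty$ (with $p,t$ fixed), $$\mathrm{R}^{\sharp}_{k,t}(\mathcal B\mid B_p)\ge p+\frac{(h_p(t)-1)\bigl(\log_2 k-\log_2 c\bigr)}{\binom{p}{\lfloor p/2\rfloor}(1+o(1))},$$ where this $o(1)$ denotes a function of $k$ tending to $0$ as $k\to\infty$.
   Context: $B_n=2^{[n]}$ denotes the Boolean lattice of all subsets of $[n]$ ordered by inclusion, and $\mathcal B=\{B_n:n\ge1\}$. A $t$-chain in a poset is a set of $t$ distinct pairwise comparable elements; $h_p(t)$ is the number of $t$-chains in $B_p$. An induced copy of a poset $P$ in a poset $R$ is the image $f(P)$ of an injection $f:P\to R$ such that $x\le y$ in $P$ if and only if $f(x)\le f(y)$ in $R$. A strong $(p,2,t)$-coloring of $B_n$ is a coloring of the $t$-chains of $B_n$ such that, for every induced copy $S\subseteq B_n$ of $B_p$, the $t$-chains contained in $S$ receive at least $2$ distinct colors. $f_t^\sharp(n,p,2)$ is the minimum number of colors in a strong $(p,2,t)$-coloring of $B_n$. The strong Boolean Ramsey number $\mathrm{R}^{\sharp}_{k,t}(\mathcal B\mid B_p)$ is the smallest $N$ such that every $k$-coloring of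 the $t$-chains of $B_N$ (assignment of one of $k$ colors to each $t$-chain) contains an induced copy of $B_p$ all of whose $t$-chains have the same color. *)

theory Defs
  imports Complex_Main "HOL-Library.Extended_Real"
begin

definition boolean_lattice :: "nat \<Rightarrow> nat set set" where
  "boolean_lattice n = Pow {1..n}"

definition t_chains :: "nat \<Rightarrow> 'a set set \<Rightarrow> 'a set set set" where
  "t_chains t F = {C. C \<subseteq> F \<and> finite C \<and> card C = t \<and> chain\<^sub>\<subseteq> C}"

definition chain_count :: "nat \<Rightarrow> nat \<Rightarrow> nat" where
  "chain_count p t = card (t_chains t (boolean_lattice p))"

definition induced_copy :: "'a set set \<Rightarrow> 'b set set \<Rightarrow> 'b set set \<Rightarrow> bool" where
  "induced_copy P R S \<longleftrightarrow>
     (\<exists>f. f ` P \<subseteq> R \<and> inj_on f P \<and> (\<forall>x\<in>P. \<forall>y\<in>P. x \<subseteq> y \<longleftrightarrow> f x \<subseteq> f y) \<and> S = f ` P)"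

text \<open>
  Colorings are total functions into the natural numbers; only their values on the
  \<open>t\<close>-chains of the lattice in question matter.
\<close>

definition strong_coloring ::
    "nat \<Rightarrow> nat \<Rightarrow> nat \<Rightarrow> nat \<Rightarrow> (nat set set \<Rightarrow> nat) \<Rightarrow> bool" where
  "strong_coloring p q t n \<chi> \<longleftrightarrow>
     (\<forall>S. induced_copy (boolean_lattice p) (boolean_lattice n) S \<longrightarrow>
          card (\<chi> ` t_chains t S) \<ge> q)"

text \<open>
  \<open>f_sharp t n p q\<close> is $f_t^\sharp(n,p,q)$.  The minimum exists whenever
  \<open>q \<le> chain_count p t\<close>, since an injective coloring is then strong; for \<open>q = 2\<close>
  this covers all \<open>p \<ge> 2\<close> and \<open>1 \<le> t \<le> p\<close>.
\<close>

definition f_sharp :: "nat \<Rightarrow> nat \<Rightarrow> nat \<Rightarrow> nat \<Rightarrow> nat" where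
  "f_sharp t n p q =
     (LEAST m. \<exists>\<chi>. strong_coloring p q t n \<chi> \<and>
                    card (\<chi> ` t_chains t (boolean_lattice n)) = m)"

definition monochromatic :: "nat \<Rightarrow> (nat set set \<Rightarrow> nat) \<Rightarrow> nat set set \<Rightarrow> bool" where
  "monochromatic t \<chi> S \<longleftrightarrow> (\<exists>i. \<forall>C\<in>t_chains t S. \<chi> C = i)"

definition ramsey_dimension :: "nat \<Rightarrow> nat \<Rightarrow> nat \<Rightarrow> nat \<Rightarrow> bool" where
  "ramsey_dimension k t p N \<longleftrightarrow>
     (\<forall>\<chi>. \<chi> ` t_chains t (boolean_lattice N) \<subseteq> {..<k} \<longrightarrow>
          (\<exists>S. induced_copy (boolean_lattice p) (boolean_lattice N) S \<and> monochromatic t \<chi> S))"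

text \<open>
  The smallest \<open>N \<ge> 1\<close> with the Ramsey property, taken in the extended naturals so that the
  definition does not presuppose that such an \<open>N\<close> exists (the infimum of the empty set is
  \<open>\<infinity>\<close>; the infimum of a nonempty set of extended naturals is attained).
\<close>

definition strong_boolean_ramsey :: "nat \<Rightarrow> nat \<Rightarrow> nat \<Rightarrow> enat" where
  "strong_boolean_ramsey k t p = Inf (enat ` {N. N \<ge> 1 \<and> ramsey_dimension k t p N})"

end

theory Submission
  imports Defs
begin

text \<open>
  The bound is an inversion of the upper bound on \<^const>\<open>f_sharp\<close>.  A strong coloring of the
  \<open>t\<close>-chains of $B_N$ for copies of $B_p$ and two colors is precisely a coloring without
  a monochromatic copy of $B_p$.  So if the Ramsey number for $k \ge 1$ colors is a finite $N$, then no
  strong coloring of $B_N$ has at most $k$ colors, that is, $f_t^\sharp(N,p,2) > k$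
  (lemma \<open>ramsey_dimension_less_f_sharp\<close>).  Moreover $N \ge p$, since $B_N$ contains a copy of
  $B_p$.  The assumed upper bound therefore applies at $n = N$, and taking logarithms and
  solving for $N$ gives the claim with $\delta(k) = \varepsilon(N)$.

  What makes this $\delta$ tend to $0$ is that $N$ tends to infinity with $k$: each
  $f_t^\sharp(n,p,2)$ is a fixed finite number, so a given $n$ satisfies
  $k < f_t^\sharp(n,p,2)$ only for finitely many $k$.

  The step $f_t^\sharp(N,p,2) > k$ requires that the minimum defining $f_t^\sharp$ is attained.
  It is, because $B_p$ has two distinct \<open>t\<close>-chains when $1 \le t \le p$, which
  makes every injective coloring strong.  The same fact gives $h_p(t) - 1 > 0$, the
  denominator in the exponent.
\<close>

lemma finite_boolean_lattice [simp]: "finite (boolean_lattice n)"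
  by (simp add: boolean_lattice_def)

lemma finite_t_chains: "finite F \<Longrightarrow> finite (t_chains t F)"
  by (rule finite_subset[of _ "Pow F"]) (auto simp: t_chains_def)

lemma image_t_chains:
  assumes "C \<in> t_chains t P" "inj_on f P" "\<forall>x\<in>P. \<forall>y\<in>P. x \<subseteq> y \<longrightarrow> f x \<subseteq> f y"
  shows "f ` C \<in> t_chains t (f ` P)"
proof -
  have "C \<subseteq> P" "finite C" "card C = t" "\<forall>x\<in>C. \<forall>y\<in>C. x \<subseteq> y \<or> y \<subseteq> x"
    using assms(1) by (auto simp: t_chains_def chain_subset_def)
  moreover from this have "\<forall>x\<in>C. \<forall>y\<in>C. f x \<subseteq> f y \<or> f y \<subseteq> f x"
    using assms(3) by (meson subsetD)
  moreover have "card (f ` C) = card C"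
    using assms(2) \<open>C \<subseteq> P\<close> by (intro card_image) (rule inj_on_subset)
  ultimately show ?thesis
    by (simp add: t_chains_def chain_subset_def image_mono)
qed

lemma card_t_chains_induced_copy:
  assumes "induced_copy P R S" "finite R"
  shows "card (t_chains t P) \<le> card (t_chains t S)"
proof -
  obtain f where f: "f ` P \<subseteq> R" "inj_on f P" "\<forall>x\<in>P. \<forall>y\<in>P. x \<subseteq> y \<longleftrightarrow> f x \<subseteq> f y" "S = f ` P"
    using assms(1) unfolding induced_copy_def by blast
  have "finite S"
    using f(1,4) assms(2) finite_subset by blast
  moreover have "inj_on (image f) (t_chains t P)"
    by (rule inj_on_subset[OF inj_on_image_Pow[OF f(2)]]) (auto simp: t_chains_def)
  moreover have "image f ` t_chains t P \<subseteq> t_chains t S"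
    unfolding f(4) by (rule image_subsetI, erule image_t_chains) (use f(2,3) in simp_all)
  ultimately show ?thesis
    using finite_t_chains by (intro card_inj_on_le[of "image f"])
qed

text \<open>
  The maximal chain \<open>{} \<subset> {1} \<subset> \<dots> \<subset> {1..p}\<close> has $p + 1 > t$ members, so its first
  $t$ members and the $t$ members after the empty set form two different \<open>t\<close>-chains.
\<close>

lemma chain_count_ge_2:
  assumes "1 \<le> t" "t \<le> p"
  shows "2 \<le> chain_count p t"
proof -
  define g :: "nat \<Rightarrow> nat set" where "g i = {1..i}" for i
  have inj: "inj g"
  proof (rule injI)
    fix i j
    assume "g i = g j"
    then have "card {1..i} = card {1..j}"
      unfolding g_def by (rule arg_cong)
    then show "i = j"
      by simp
  qed
  have chain: "g ` I \<in> t_chains t (boolean_lattice p)" if "I \<subseteq> {..p}" "card I = t" for I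
  proof -
    have "finite I"
      using that(1) finite_subset by blast
    moreover have "card (g ` I) = t"
      using that(2) card_image[OF inj_on_subset[OF inj subset_UNIV]] by metis
    moreover have "g ` I \<subseteq> boolean_lattice p"
      using that(1) by (auto simp: g_def boolean_lattice_def)
    moreover have "g i \<subseteq> g j \<or> g j \<subseteq> g i" for i j
      by (auto simp: g_def)
    ultimately show ?thesis
      by (auto simp: t_chains_def chain_subset_def)
  qed
  have "0 \<in> {0..<t}" "0 \<notin> {1..t}"
    using assms(1) by auto
  then have "g ` {0..<t} \<noteq> g ` {1..t}"
    unfolding inj_image_eq_iff[OF inj] by blast
  then have "2 = card {g ` {0..<t}, g ` {1..t}}"
    by simp
  also have "\<dots> \<le> chain_count p t"
    unfolding chain_count_def
    by (rule card_mono) (use assms chain in \<open>auto simp: finite_t_chains subset_iff\<close>)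
  finally show ?thesis .
qed

lemma strong_coloring_exists:
  assumes "q \<le> chain_count p t"
  shows "\<exists>\<chi>. strong_coloring p q t n \<chi>"
proof -
  obtain \<chi> :: "nat set set \<Rightarrow> nat" where inj: "inj_on \<chi> (t_chains t (boolean_lattice n))"
    using finite_imp_inj_to_nat_seg[OF finite_t_chains[OF finite_boolean_lattice]] by metis
  have "q \<le> card (\<chi> ` t_chains t S)" if S: "induced_copy (boolean_lattice p) (boolean_lattice n) S" for S
  proof -
    have "t_chains t S \<subseteq> t_chains t (boolean_lattice n)"
      using S by (auto simp: induced_copy_def t_chains_def)
    then have "card (\<chi> ` t_chains t S) = card (t_chains t S)"
      by (meson card_image inj inj_on_subset)
    then show ?thesis
      using assms card_t_chains_induced_copy[OF S finite_boolean_lattice, of t]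
      by (simp add: chain_count_def)
  qed
  then show ?thesis
    unfolding strong_coloring_def by blast
qed

lemma f_sharp_attained:
  assumes "q \<le> chain_count p t"
  obtains \<chi> where "strong_coloring p q t n \<chi>"
    "card (\<chi> ` t_chains t (boolean_lattice n)) = f_sharp t n p q"
proof -
  have "\<exists>m \<chi>. strong_coloring p q t n \<chi> \<and> card (\<chi> ` t_chains t (boolean_lattice n)) = m"
    using strong_coloring_exists[OF assms] by blast
  then show thesis
    using LeastI_ex[of "\<lambda>m. \<exists>\<chi>. strong_coloring p q t n \<chi> \<and>
        card (\<chi> ` t_chains t (boolean_lattice n)) = m"] that
    unfolding f_sharp_def by blast
qed

text \<open>
  An optimal strong coloring with at most $k$ colors can be renamed to use colors below $k$;
  the Ramsey property would then give a copy of $B_p$ whose chains have only one color.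
\<close>

lemma ramsey_dimension_less_f_sharp:
  assumes ramsey: "ramsey_dimension k t p N" and "2 \<le> chain_count p t"
  shows "k < f_sharp t N p 2"
proof (rule ccontr)
  assume le: "\<not> k < f_sharp t N p 2"
  let ?T = "t_chains t (boolean_lattice N)"
  obtain \<chi> where strong: "strong_coloring p 2 t N \<chi>" and card: "card (\<chi> ` ?T) = f_sharp t N p 2"
    using f_sharp_attained[OF assms(2)] .
  have fin: "finite (\<chi> ` ?T)"
    by (simp add: finite_t_chains)
  obtain h where h: "bij_betw h (\<chi> ` ?T) {0..<card (\<chi> ` ?T)}"
    using ex_bij_betw_finite_nat[OF fin] by blast
  have "(h \<circ> \<chi>) ` ?T = {0..<f_sharp t N p 2}"
    using h card unfolding bij_betw_def image_comp[symmetric] by metis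
  also have "\<dots> \<subseteq> {..<k}"
    using le by auto
  finally have "(h \<circ> \<chi>) ` ?T \<subseteq> {..<k}" .
  then obtain S i where S: "induced_copy (boolean_lattice p) (boolean_lattice N) S"
    and mono: "\<forall>C\<in>t_chains t S. (h \<circ> \<chi>) C = i"
    using ramsey unfolding ramsey_dimension_def monochromatic_def by blast
  have sub: "t_chains t S \<subseteq> ?T"
    using S by (auto simp: induced_copy_def t_chains_def)
  have "inj_on h (\<chi> ` t_chains t S)"
    using h sub by (meson bij_betw_imp_inj_on image_mono inj_on_subset)
  then have "card (\<chi> ` t_chains t S) = card (h ` \<chi> ` t_chains t S)"
    by (simp add: card_image)
  also have "\<dots> \<le> card {i}"
    by (rule card_mono) (use mono in auto)
  finally show False
    using strong S unfolding strong_coloring_def by fastforce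
qed

lemma induced_copy_boolean_lattice_le:
  assumes "induced_copy (boolean_lattice p) (boolean_lattice N) S"
  shows "p \<le> N"
proof -
  have "card (boolean_lattice p) \<le> card (boolean_lattice N)"
    using assms unfolding induced_copy_def by (metis card_inj_on_le finite_boolean_lattice)
  then show ?thesis
    by (simp add: boolean_lattice_def card_Pow)
qed

lemma ramsey_dimension_ge:
  assumes "ramsey_dimension k t p N" "0 < k"
  shows "p \<le> N"
proof -
  have "(\<lambda>_. 0) ` t_chains t (boolean_lattice N) \<subseteq> {..<k}"
    using assms(2) by auto
  then show ?thesis
    using assms(1) induced_copy_boolean_lattice_le unfolding ramsey_dimension_def by blast
qed

lemma strong_boolean_ramsey_attained:
  assumes "strong_boolean_ramsey k t p = enat N"
  shows "ramsey_dimension k t p N"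
proof -
  let ?A = "enat ` {N. N \<ge> 1 \<and> ramsey_dimension k t p N}"
  have "?A \<noteq> {}"
    using assms unfolding strong_boolean_ramsey_def Inf_enat_def by fastforce
  then have "Inf ?A \<in> ?A"
    by (meson ex_in_conv wellorder_InfI)
  then show ?thesis
    using assms by (auto simp: strong_boolean_ramsey_def)
qed

theorem corollary6p2:
  fixes p t :: nat and c :: real
  assumes "p \<ge> 2" and "1 \<le> t" and "t \<le> p" and "c > 0"
    and "\<exists>\<epsilon> :: nat \<Rightarrow> real. \<epsilon> \<longlonglongrightarrow> 0 \<and>
      (\<forall>n\<ge>p. real (f_sharp t n p 2) \<le>
         c * 2 powr ((real n - real p) * real (p choose (p div 2)) * (1 + \<epsilon> n)
                      / (real (chain_count p t) - 1)))"
  shows "\<exists>\<delta> :: nat \<Rightarrow> real. \<delta> \<longlonglongrightarrow> 0 \<and>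
      (\<forall>\<^sub>F k in sequentially.
         ereal_of_enat (strong_boolean_ramsey k t p) \<ge>
         ereal (real p + (real (chain_count p t) - 1) * (log 2 (real k) - log 2 c)
                          / (real (p choose (p div 2)) * (1 + \<delta> k))))"
proof -
  obtain \<epsilon> :: "nat \<Rightarrow> real" where \<epsilon>: "\<epsilon> \<longlonglongrightarrow> 0"
    and bound: "\<And>n. p \<le> n \<Longrightarrow> real (f_sharp t n p 2) \<le>
         c * 2 powr ((real n - real p) * real (p choose (p div 2)) * (1 + \<epsilon> n)
                      / (real (chain_count p t) - 1))"
    using assms(5) by blast
  let ?R = "\<lambda>k. strong_boolean_ramsey k t p"
  define M where "M = real (p choose (p div 2))"
  define H where "H = real (chain_count p t) - 1"
  have M: "M > 0"
    by (simp add: M_def)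
  have h2: "2 \<le> chain_count p t"
    using assms(2,3) by (rule chain_count_ge_2)
  then have H: "H > 0"
    by (simp add: H_def)
  have less: "k < f_sharp t N p 2" if "?R k = enat N" for k N
    using ramsey_dimension_less_f_sharp[OF strong_boolean_ramsey_attained[OF that] h2] .
  \<comment> \<open>An infinite Ramsey number exceeds every real bound, so there \<open>\<delta> k\<close> matters only for the limit.\<close>
  define \<delta> where "\<delta> k = (case ?R k of enat N \<Rightarrow> \<epsilon> N | \<infinity> \<Rightarrow> 0)" for k
  have "\<delta> \<longlonglongrightarrow> 0"
  proof (rule LIMSEQ_I)
    fix r :: real
    assume "0 < r"
    then obtain n0 where n0: "\<And>n. n0 \<le> n \<Longrightarrow> norm (\<epsilon> n - 0) < r"
      using LIMSEQ_D[OF \<epsilon>] by blast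
    \<comment> \<open>Once \<open>k\<close> reaches all the values \<open>f_sharp t n p 2\<close> with \<open>n < n0\<close>,
      the Ramsey number is at least \<open>n0\<close>.\<close>
    have "norm (\<delta> k - 0) < r" if k: "(\<Sum>n<n0. f_sharp t n p 2) \<le> k" for k
    proof (cases "?R k")
      case (enat N)
      have "n0 \<le> N"
      proof (rule ccontr)
        assume "\<not> n0 \<le> N"
        then have "f_sharp t N p 2 \<le> (\<Sum>n<n0. f_sharp t n p 2)"
          by (intro member_le_sum) auto
        then show False
          using less[OF enat] k by simp
      qed
      then show ?thesis
        using n0 enat by (simp add: \<delta>_def)
    qed (simp add: \<delta>_def \<open>0 < r\<close>)
    then show "\<exists>no. \<forall>k\<ge>no. norm (\<delta> k - 0) < r"
      by blast
  qed
  moreover have "\<forall>\<^sub>F k in sequentially. ereal (real p + H * (log 2 (real k) - log 2 c) / (M * (1 + \<delta> k)))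
      \<le> ereal_of_enat (?R k)"
  proof -
    \<comment> \<open>Dividing by \<open>1 + \<delta> k\<close> preserves the inequality only when this factor is positive.\<close>
    have "\<forall>\<^sub>F k in sequentially. -1 < \<delta> k"
      using \<open>\<delta> \<longlonglongrightarrow> 0\<close> by (rule order_tendstoD) simp
    then show ?thesis
      using eventually_gt_at_top[of 0]
    proof eventually_elim
      case (elim k)
      show ?case
      proof (cases "?R k")
        case (enat N)
        have "p \<le> N"
          using ramsey_dimension_ge strong_boolean_ramsey_attained[OF enat] elim(2) .
        have \<delta>: "\<delta> k = \<epsilon> N"
          by (simp add: \<delta>_def enat)
        have "real k < c * 2 powr ((real N - real p) * M * (1 + \<epsilon> N) / H)"
          using less[OF enat] bound[OF \<open>p \<le> N\<close>] by (simp add: M_def H_def)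
        then have "log 2 (real k) < log 2 (c * 2 powr ((real N - real p) * M * (1 + \<epsilon> N) / H))"
          using elim(2) by (subst log_less_cancel_iff) auto
        also have "\<dots> = log 2 c + (real N - real p) * M * (1 + \<epsilon> N) / H"
          using assms(4) by (simp add: log_mult)
        finally have "H * (log 2 (real k) - log 2 c) \<le> (real N - real p) * (M * (1 + \<delta> k))"
          using H by (simp add: \<delta> field_simps)
        moreover have "0 < M * (1 + \<delta> k)"
          using M elim(1) by simp
        ultimately have "H * (log 2 (real k) - log 2 c) / (M * (1 + \<delta> k)) \<le> real N - real p"
          by (simp add: pos_divide_le_eq)
        then show ?thesis
          by (simp add: enat)
      qed simp
    qed
  qed
  ultimately show ?thesis
    unfolding M_def H_def by blast
qed

end
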